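(* Let $0<k<1$, let $Q=[0,1]\times[0,1]$ with two-dimensional Lebesgue measure $\mu$, and let $Q_1$ be the interior of the square, with sides parallel to those of $Q$, of side length $k$ centered at $(\tfrac12,\tfrac12)$. For $\lambda\in[0,1]$ let $$\phi(\lambda)=\mu\big(\{(x,y)\in Q : y\le\lambda\}\setminus Q_1\big),$$ $$T^0(\phi(\lambda))=\{(x,y)\in Q : y\le\lambda\}\setminus Q_1,\qquad T^1(\phi(\lambda))=\{(x,y)\in Q : y\ge 1-\lambda\}\setminus Q_1,$$ and let $\mathcal{T}^0=\{T^0(\phi(\lambda)) : 0\le\lambda\le 1\}$. Define on $\mathcal{T}^0$ $$T^0(\phi(a))\oplus T^0(\phi(b))=T^0\big(\mu[T^0(\phi(a))\cup T^1(\phi(b))]\big),\qquad \neg T^0(\phi(\lambda))=T^0\big((1-k^2)-\phi(\lambda)\big),$$ and let $0=T^0(0)$ and $1=T^0(1-k^2)=Q\setminus Q_1$. Then $(\mathcal{T}^0,\oplus,\neg,0,1)$ is an MV-algebra.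
   Context: The sets $T^0(t)$ and $T^1(t)$ are parameterized by their measure $t=\phi(\lambda)\in[0,1-k^2]$: for $t\in[0,1-k^2]$, $T^0(t)$ means $T^0(\phi(\lambda))$ for the $\lambda\in[0,1]$ with $\phi(\lambda)=t$, and similarly for $T^1(t)$. An MV-algebra is a structure $(A,\oplus,\neg,0,1)$ such that $(A,\oplus,0)$ is a commutative monoid with identity $0$, and for all $x,y\in A$: (i) $\neg(\neg x)=x$; (ii) $1\oplus x=1$; (iii) $x\oplus\neg 0=\neg 0$; (iv) $\neg(\neg x\oplus y)\oplus y=\neg(\neg y\oplus x)\oplus x$. *)

theory Defs
  imports "HOL-Analysis.Analysis" "HOL-Algebra.Group"
begin

text \<open>
  MV-algebras with an explicit carrier. Closure of the carrier under addition and membership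
  of zero are part of \<^const>\<open>comm_monoid\<close>.
\<close>

locale mv_algebra =
  fixes A :: "'a set"
    and oplus :: "'a \<Rightarrow> 'a \<Rightarrow> 'a"
    and neg :: "'a \<Rightarrow> 'a"
    and zero :: 'a
    and one :: 'a
  assumes oplus_comm_monoid:
      "comm_monoid \<lparr>carrier = A, monoid.mult = oplus, monoid.one = zero\<rparr>"
    and neg_closed: "x \<in> A \<Longrightarrow> neg x \<in> A"
    and one_closed: "one \<in> A"
    and neg_neg: "x \<in> A \<Longrightarrow> neg (neg x) = x"
    and one_oplus: "x \<in> A \<Longrightarrow> oplus one x = one"
    and oplus_neg_zero: "x \<in> A \<Longrightarrow> oplus x (neg zero) = neg zero"
    and lukasiewicz: "x \<in> A \<Longrightarrow> y \<in> A \<Longrightarrow>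
      oplus (neg (oplus (neg x) y)) y = oplus (neg (oplus (neg y) x)) x"

definition Q :: "(real \<times> real) set" where
  "Q = {0..1} \<times> {0..1}"

definition Q1 :: "real \<Rightarrow> (real \<times> real) set" where
  "Q1 k = interior ({1/2 - k/2..1/2 + k/2} \<times> {1/2 - k/2..1/2 + k/2})"

definition lower_strip :: "real \<Rightarrow> real \<Rightarrow> (real \<times> real) set" where
  "lower_strip k l = {(x, y). (x, y) \<in> Q \<and> y \<le> l} - Q1 k"

definition upper_strip :: "real \<Rightarrow> real \<Rightarrow> (real \<times> real) set" where
  "upper_strip k l = {(x, y). (x, y) \<in> Q \<and> y \<ge> 1 - l} - Q1 k"

definition phi :: "real \<Rightarrow> real \<Rightarrow> real" where
  "phi k l = measure lebesgue (lower_strip k l)"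

text \<open>
  The argument of \<open>T0\<close> and \<open>T1\<close> is the measure \<open>t = phi k l\<close>, not the height \<open>l\<close>;
  they are meaningful for \<open>t\<close> between \<open>0\<close> and \<open>1 - k\<^sup>2\<close>.
\<close>

definition T0 :: "real \<Rightarrow> real \<Rightarrow> (real \<times> real) set" where
  "T0 k t = lower_strip k (THE l. l \<in> {0..1} \<and> phi k l = t)"

definition T1 :: "real \<Rightarrow> real \<Rightarrow> (real \<times> real) set" where
  "T1 k t = upper_strip k (THE l. l \<in> {0..1} \<and> phi k l = t)"

definition T0_family :: "real \<Rightarrow> (real \<times> real) set set" where
  "T0_family k = {T0 k (phi k l) | l. 0 \<le> l \<and> l \<le> 1}"

text \<open>
  The operations act on members of the family, through any of their representations
  \<open>T0 k (phi k a)\<close>; the description is proper because such a representation is unique.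
\<close>

definition T0_oplus ::
    "real \<Rightarrow> (real \<times> real) set \<Rightarrow> (real \<times> real) set \<Rightarrow> (real \<times> real) set" where
  "T0_oplus k X Y = (THE Z. \<exists>a\<in>{0..1}. \<exists>b\<in>{0..1}.
      X = T0 k (phi k a) \<and> Y = T0 k (phi k b) \<and>
      Z = T0 k (measure lebesgue (T0 k (phi k a) \<union> T1 k (phi k b))))"

definition T0_neg :: "real \<Rightarrow> (real \<times> real) set \<Rightarrow> (real \<times> real) set" where
  "T0_neg k X = (THE Z. \<exists>l\<in>{0..1}.
      X = T0 k (phi k l) \<and> Z = T0 k ((1 - k\<^sup>2) - phi k l))"

end

theory Submission imports Defs begin

text \<open>
  Parametrised by its measure \<open>t \<in> [0, M]\<close> with \<open>M = 1 - k\<^sup>2\<close>, the family is a copy of the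
  Lukasiewicz algebra on \<open>[0, M]\<close>. Indeed \<open>phi k\<close> is strictly increasing and 1-Lipschitz, hence a
  bijection onto \<open>[0, M]\<close>. The point reflection in the centre of \<open>Q\<close> exchanges lower and upper strips,
  so the upper strip of height \<open>b\<close> has measure \<open>phi k b\<close> too. Lower strip \<open>a\<close> and upper strip \<open>b\<close> are
  disjoint if \<open>a + b < 1\<close> and cover \<open>Q - Q1 k\<close> otherwise, so their union has measure
  \<open>min (phi k a + phi k b) M\<close>.
\<close>

section \<open>Areas of rectangles and the shape of the strips\<close>

lemma measure_cbox_Pair:
  fixes a b c d :: real
  assumes "a \<le> b" "c \<le> d"
  shows "measure lebesgue ({a..b} \<times> {c..d}) = (b - a) * (d - c)"
proof -
  have "measure lebesgue (cbox (a, c) (b, d)) = measure lborel (cbox (a, c) (b, d))"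
    by simp
  then show ?thesis
    using content_Pair[of a c b d] assms by (simp only: cbox_Pair_eq) simp
qed

lemma measure_Times_singleton: "measure lebesgue ({0..1::real} \<times> {c::real}) = 0"
  using measure_cbox_Pair[of 0 1 c c] by simp

lemma lmeasurable_Times_interval [simp]:
  fixes a b c d :: real
  shows "{a..b} \<times> {c..d} \<in> lmeasurable"
  using lmeasurable_cbox[of "(a, c)" "(b, d)"] by (simp add: cbox_Pair_eq)

lemma measure_box_Pair:
  fixes a b c d :: real
  assumes "a \<le> b" "c \<le> d"
  shows "measure lebesgue ({a<..<b} \<times> {c<..<d}) = (b - a) * (d - c)"
proof -
  \<comment> \<open>Open and closed boxes have the same measure formula, the boundary being
    null.\<close>
  have "measure lebesgue (box (a, c) (b, d)) = measure lborel (cbox (a, c) (b, d))"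
    by (simp add: measure_def emeasure_lborel_box_eq emeasure_lborel_cbox_eq)
  then show ?thesis
    using content_Pair[of a c b d] assms by (simp add: box_prod)
qed

lemma lmeasurable_box_Times [simp]:
  fixes a b c d :: real
  shows "{a<..<b} \<times> {c<..<d} \<in> lmeasurable"
  using lmeasurable_box[of "(a, c)" "(b, d)"] by (simp add: box_prod)

lemma Q1_eq: "Q1 k = {1/2 - k/2<..<1/2 + k/2} \<times> {1/2 - k/2<..<1/2 + k/2}"
  by (simp add: Q1_def interior_Times)

text \<open>A closed rectangle minus an open box is visibly measurable; \<open>min\<close> here, and
  \<open>max\<close> in the upper version, make the equation hold for every real
  \<open>l\<close>.\<close>

lemma lower_strip_eq: "lower_strip k l = {0..1} \<times> {0..min 1 l} - Q1 k"
  by (auto simp: lower_strip_def Q_def)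

lemma upper_strip_eq: "upper_strip k l = {0..1} \<times> {max 0 (1 - l)..1} - Q1 k"
  by (auto simp: upper_strip_def Q_def)

lemma lmeasurable_strips [simp]:
  "lower_strip k l \<in> lmeasurable" "upper_strip k l \<in> lmeasurable"
  by (simp_all add: lower_strip_eq upper_strip_eq Q1_eq fmeasurable_Diff fmeasurableD)

lemma lower_strip_1: "lower_strip k 1 = Q - Q1 k"
  by (auto simp: lower_strip_def Q_def)

text \<open>The reflection maps \<open>Q\<close> and the centred hole to themselves. It is written
  as scaling by -1 plus a translation so that \<open>measure_lebesgue_affine\<close> applies; the
  scaling factor for areas is then 1.\<close>

lemma upper_strip_eq_image: "upper_strip k l = (\<lambda>p. (-1) *\<^sub>R p + (1, 1)) ` lower_strip k l"
proof (intro equalityI subsetI)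
  fix p assume "p \<in> upper_strip k l"
  then have "(1, 1) - p \<in> lower_strip k l"
    by (cases p) (auto simp: lower_strip_def upper_strip_def Q_def Q1_eq)
  moreover have "p = (-1) *\<^sub>R ((1, 1) - p) + (1, 1)"
    by (cases p) simp
  ultimately show "p \<in> (\<lambda>p. (-1) *\<^sub>R p + (1, 1)) ` lower_strip k l"
    by (rule rev_image_eqI)
next
  fix p assume "p \<in> (\<lambda>p. (-1) *\<^sub>R p + (1, 1)) ` lower_strip k l"
  then show "p \<in> upper_strip k l"
    by (auto simp: lower_strip_def upper_strip_def Q_def Q1_eq)
qed

lemma measure_upper_strip: "measure lebesgue (upper_strip k l) = phi k l"
  unfolding upper_strip_eq_image phi_def by (subst measure_lebesgue_affine) simp

section \<open>The measure function \<open>phi k\<close> as a bijection\<close>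

context
  fixes k :: real
  assumes k_pos: "0 < k" and k_less_1: "k < 1"
begin

lemma phi_0: "phi k 0 = 0"
proof -
  have "phi k 0 \<le> measure lebesgue ({0..1::real} \<times> {0..0::real})"
    unfolding phi_def
    by (intro measure_mono_fmeasurable lmeasurable_Times_interval) (auto simp: fmeasurableD, auto simp: lower_strip_eq)
  moreover have "0 \<le> phi k 0"
    by (simp add: phi_def)
  ultimately show ?thesis
    by (simp add: measure_Times_singleton)
qed

lemma phi_1: "phi k 1 = 1 - k\<^sup>2"
proof -
  have "Q1 k \<subseteq> Q"
    using k_pos k_less_1 by (auto simp: Q1_eq Q_def)
  then have "measure lebesgue (Q - Q1 k) = measure lebesgue Q - measure lebesgue (Q1 k)"
    by (intro measurable_measure_Diff) (auto simp: Q_def Q1_eq fmeasurableD)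
  also have "measure lebesgue Q = 1"
    by (simp add: Q_def measure_cbox_Pair)
  also have "measure lebesgue (Q1 k) = k\<^sup>2"
    using k_pos unfolding Q1_eq by (subst measure_box_Pair) (auto simp: power2_eq_square)
  finally show ?thesis
    by (simp add: phi_def lower_strip_1)
qed

lemma phi_less:
  assumes "0 \<le> l" "l < m" "m \<le> 1"
  shows "phi k l < phi k m"
proof -
  \<comment> \<open>The hole begins at x = 1/2 - k/2 = (1 - k)/2, so this box lies in the margin to
    its left. Being open, it also misses the line y = l. Its area is the guaranteed growth.\<close>
  let ?R = "{0<..<(1 - k)/2} \<times> {l<..<m}"
  have disj: "lower_strip k l \<inter> ?R = {}"
    by (auto simp: lower_strip_def)
  have "?R \<subseteq> lower_strip k m"
    using assms k_pos k_less_1 by (auto simp: lower_strip_def Q_def Q1_eq field_simps)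
  moreover have "lower_strip k l \<subseteq> lower_strip k m"
    using assms by (auto simp: lower_strip_def)
  ultimately have "measure lebesgue (lower_strip k l \<union> ?R) \<le> phi k m"
    unfolding phi_def by (intro measure_mono_fmeasurable) (auto simp: fmeasurableD)
  moreover have "measure lebesgue (lower_strip k l \<union> ?R) = phi k l + (1 - k)/2 * (m - l)"
    using assms k_less_1 disj by (simp add: measure_Un3 phi_def measure_box_Pair)
  moreover have "0 < (1 - k)/2 * (m - l)"
    using assms k_less_1 by simp
  ultimately show ?thesis by linarith
qed

lemma phi_less_iff:
  assumes "l \<in> {0..1}" "m \<in> {0..1}"
  shows "phi k l < phi k m \<longleftrightarrow> l < m"
  using assms phi_less[of l m] phi_less[of m l] by (cases l m rule: linorder_cases) auto

text \<open>Passing from height \<open>l\<close> to \<open>m\<close> adds at most a full-width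
  rectangle; ignoring the hole only enlarges the bound.\<close>

lemma phi_diff_le:
  assumes "0 \<le> l" "l \<le> m" "m \<le> 1"
  shows "phi k m - phi k l \<le> m - l"
proof -
  let ?R = "{0..1::real} \<times> {l..m}"
  have "phi k m \<le> measure lebesgue (lower_strip k l \<union> ?R)"
    unfolding phi_def
    by (intro measure_mono_fmeasurable fmeasurable.Un lmeasurable_strips lmeasurable_Times_interval)
      (use assms in \<open>auto simp: fmeasurableD, auto simp: lower_strip_def Q_def\<close>)
  also have "\<dots> \<le> phi k l + measure lebesgue ?R"
    by (simp add: phi_def measure_Un_le fmeasurableD)
  finally show ?thesis
    using assms by (simp add: measure_cbox_Pair)
qed

lemma continuous_on_phi: "continuous_on {0..1} (phi k)"
proof -
  have "\<bar>phi k l - phi k m\<bar> \<le> \<bar>l - m\<bar>" if "l \<in> {0..1}" "m \<in> {0..1}" for l m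
    using that phi_diff_le[of l m] phi_diff_le[of m l] phi_less[of l m] phi_less[of m l]
    by (cases l m rule: linorder_cases) auto
  then have "1-lipschitz_on {0..1} (phi k)"
    by (intro lipschitz_onI) (auto simp: dist_real_def)
  then show ?thesis
    by (rule lipschitz_on_continuous_on)
qed

lemma inj_on_phi: "inj_on (phi k) {0..1}"
  by (metis inj_onI phi_less_iff linorder_cases less_irrefl)

lemma phi_image: "phi k ` {0..1} = {0..1 - k\<^sup>2}"
proof (intro equalityI subsetI)
  fix t assume "t \<in> phi k ` {0..1}"
  then obtain l where l: "l \<in> {0..1}" "t = phi k l" by blast
  then show "t \<in> {0..1 - k\<^sup>2}"
    using phi_less_iff[of l 0] phi_less_iff[of 1 l] by (simp add: phi_0 phi_1 not_less[symmetric])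
next
  fix t assume "t \<in> {0..1 - k\<^sup>2}"
  then show "t \<in> phi k ` {0..1}"
    using IVT'[of "phi k" 0 t 1] continuous_on_phi by (auto simp: phi_0 phi_1)
qed

lemma bij_betw_phi: "bij_betw (phi k) {0..1} {0..1 - k\<^sup>2}"
  by (simp add: bij_betw_def inj_on_phi phi_image)

section \<open>Members of the family indexed by their measure\<close>

lemma the_phi_eq:
  assumes "l \<in> {0..1}"
  shows "(THE m. m \<in> {0..1} \<and> phi k m = phi k l) = l"
  using assms inj_on_phi by (intro the_equality) (auto dest: inj_onD)

lemma T0_phi: "l \<in> {0..1} \<Longrightarrow> T0 k (phi k l) = lower_strip k l"
  using the_phi_eq by (simp add: T0_def)

lemma T1_phi: "l \<in> {0..1} \<Longrightarrow> T1 k (phi k l) = upper_strip k l"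
  using the_phi_eq by (simp add: T1_def)

lemma phi_cases:
  assumes "t \<in> {0..1 - k\<^sup>2}"
  obtains l where "l \<in> {0..1}" "t = phi k l"
  using assms phi_image by (metis imageE)

lemma measure_T0: "t \<in> {0..1 - k\<^sup>2} \<Longrightarrow> measure lebesgue (T0 k t) = t"
  by (metis phi_cases T0_phi phi_def)

text \<open>\<open>measure lebesgue\<close> is a left inverse of \<open>T0 k\<close> on the
  parameter interval, so a set determines its parameter.\<close>

lemma T0_eq_iff:
  "s \<in> {0..1 - k\<^sup>2} \<Longrightarrow> t \<in> {0..1 - k\<^sup>2} \<Longrightarrow> T0 k s = T0 k t \<longleftrightarrow> s = t"
  by (metis measure_T0)

lemma phi_in: "l \<in> {0..1} \<Longrightarrow> phi k l \<in> {0..1 - k\<^sup>2}"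
  using phi_image by blast

lemma T0_family_eq: "T0_family k = T0 k ` {0..1 - k\<^sup>2}"
  unfolding T0_family_def phi_image[symmetric] by auto

section \<open>Measure of the union of a lower and an upper strip\<close>

lemma strips_cover:
  assumes "a \<in> {0..1}" "b \<in> {0..1}" "1 \<le> a + b"
  shows "lower_strip k a \<union> upper_strip k b = Q - Q1 k"
  using assms by (auto simp: lower_strip_def upper_strip_def Q_def)

text \<open>The two strips cut \<open>Q - Q1 k\<close> along the line y = \<open>a\<close>: they
  cover it and overlap only in a null set on that line.\<close>

lemma phi_add_complement:
  assumes "a \<in> {0..1}"
  shows "phi k a + phi k (1 - a) = 1 - k\<^sup>2"
proof -
  have "measure lebesgue (lower_strip k a \<inter> upper_strip k (1 - a))
      \<le> measure lebesgue ({0..1::real} \<times> {a..a})"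
    using assms
    by (intro measure_mono_fmeasurable lmeasurable_Times_interval sets.Int fmeasurableD lmeasurable_strips)
      (auto simp: lower_strip_def upper_strip_def Q_def)
  then have "measure lebesgue (lower_strip k a \<inter> upper_strip k (1 - a)) = 0"
    using measure_nonneg[of lebesgue "lower_strip k a \<inter> upper_strip k (1 - a)"]
    by (simp add: measure_Times_singleton)
  then have "measure lebesgue (lower_strip k a \<union> upper_strip k (1 - a)) = phi k a + phi k (1 - a)"
    by (simp add: measure_Un3 measure_upper_strip phi_def)
  moreover have "lower_strip k a \<union> upper_strip k (1 - a) = Q - Q1 k"
    using assms by (intro strips_cover) auto
  ultimately show ?thesis
    using phi_1 by (simp add: phi_def lower_strip_1)
qed

lemma measure_strips_Un:
  assumes "a \<in> {0..1}" "b \<in> {0..1}"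
  shows "measure lebesgue (lower_strip k a \<union> upper_strip k b) = min (phi k a + phi k b) (1 - k\<^sup>2)"
proof (cases "a + b < 1")
  case True
  then have "lower_strip k a \<inter> upper_strip k b = {}"
    by (auto simp: lower_strip_def upper_strip_def)
  then have "measure lebesgue (lower_strip k a \<union> upper_strip k b) = phi k a + phi k b"
    by (simp add: measure_Un3 measure_upper_strip phi_def)
  \<comment> \<open>By \<open>phi_add_complement\<close> the right side is
    \<open>1 - k\<^sup>2 - phi k a\<close>, so the sum stays below the cap and \<open>min\<close>
    selects it.\<close>
  moreover have "phi k b < phi k (1 - a)"
    using True assms by (intro phi_less) auto
  ultimately show ?thesis
    using phi_add_complement[of a] assms by simp
next
  case False
  then have "lower_strip k a \<union> upper_strip k b = Q - Q1 k"
    using assms by (intro strips_cover) auto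
  then have "measure lebesgue (lower_strip k a \<union> upper_strip k b) = 1 - k\<^sup>2"
    using phi_1 by (simp add: phi_def lower_strip_1)
  \<comment> \<open>In the same way, the sum now reaches the cap, so \<open>min\<close> selects the
    cap.\<close>
  moreover have "\<not> phi k b < phi k (1 - a)"
    using False assms by (subst phi_less_iff) auto
  ultimately show ?thesis
    using phi_add_complement[of a] assms by simp
qed

lemma measure_T0_Un_T1:
  assumes "s \<in> {0..1 - k\<^sup>2}" "t \<in> {0..1 - k\<^sup>2}"
  shows "measure lebesgue (T0 k s \<union> T1 k t) = min (s + t) (1 - k\<^sup>2)"
  using assms by (metis phi_cases T0_phi T1_phi measure_strips_Un)

section \<open>The operations computed on parameters\<close>

lemma T0_oplus_phi:
  assumes "a \<in> {0..1}" "b \<in> {0..1}"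
  shows "T0_oplus k (T0 k (phi k a)) (T0 k (phi k b)) =
    T0 k (measure lebesgue (T0 k (phi k a) \<union> T1 k (phi k b)))"
  unfolding T0_oplus_def
proof (rule the_equality)
  fix Z
  assume "\<exists>a'\<in>{0..1}. \<exists>b'\<in>{0..1}. T0 k (phi k a) = T0 k (phi k a') \<and>
    T0 k (phi k b) = T0 k (phi k b') \<and>
    Z = T0 k (measure lebesgue (T0 k (phi k a') \<union> T1 k (phi k b')))"
  \<comment> \<open>Equal sets have equal parameters, so any other representation gives the same
    value.\<close>
  then show "Z = T0 k (measure lebesgue (T0 k (phi k a) \<union> T1 k (phi k b)))"
    using assms by (metis T0_eq_iff phi_in)
qed (use assms in blast)

lemma T0_neg_phi:
  assumes "l \<in> {0..1}"
  shows "T0_neg k (T0 k (phi k l)) = T0 k ((1 - k\<^sup>2) - phi k l)"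
  unfolding T0_neg_def
proof (rule the_equality)
  fix Z
  assume "\<exists>l'\<in>{0..1}. T0 k (phi k l) = T0 k (phi k l') \<and> Z = T0 k ((1 - k\<^sup>2) - phi k l')"
  then show "Z = T0 k ((1 - k\<^sup>2) - phi k l)"
    using assms by (metis T0_eq_iff phi_in)
qed (use assms in blast)

lemma T0_oplus_T0:
  assumes "s \<in> {0..1 - k\<^sup>2}" "t \<in> {0..1 - k\<^sup>2}"
  shows "T0_oplus k (T0 k s) (T0 k t) = T0 k (min (s + t) (1 - k\<^sup>2))"
  using assms measure_T0_Un_T1[OF assms] by (metis phi_cases T0_oplus_phi)

lemma T0_neg_T0:
  assumes "t \<in> {0..1 - k\<^sup>2}"
  shows "T0_neg k (T0 k t) = T0 k ((1 - k\<^sup>2) - t)"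
  using assms by (metis phi_cases T0_neg_phi)

section \<open>The MV-algebra laws for addition truncated at \<open>M\<close>\<close>

lemma mv_algebra_T0:
  "mv_algebra (T0_family k) (T0_oplus k) (T0_neg k) (T0 k 0) (T0 k (1 - k\<^sup>2))"
proof -
  define M where "M = 1 - k\<^sup>2"
  have M: "0 \<le> M"
    using phi_in[of 0] by (simp add: M_def)
  have oplus: "T0_oplus k (T0 k s) (T0 k t) = T0 k (min (s + t) M)"
    if "0 \<le> s" "s \<le> M" "0 \<le> t" "t \<le> M" for s t
    using that T0_oplus_T0[of s t] by (simp add: M_def)
  have neg: "T0_neg k (T0 k t) = T0 k (M - t)" if "0 \<le> t" "t \<le> M" for t
    using that T0_neg_T0[of t] by (simp add: M_def)
  have family: "T0_family k = T0 k ` {0..M}"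
    by (simp add: T0_family_eq M_def)
  show ?thesis
    unfolding M_def[symmetric] family
  proof (rule mv_algebra.intro)
    fix X Y assume "X \<in> T0 k ` {0..M}" "Y \<in> T0 k ` {0..M}"
    then obtain s t where st: "0 \<le> s" "s \<le> M" "0 \<le> t" "t \<le> M" "X = T0 k s" "Y = T0 k t"
      by auto
    \<comment> \<open>Since M - min (M - s + t) M = max (s - t) 0, the left side is max s t, which
      is symmetric in s and t.\<close>
    have "M - min (M - s + t) M + t = M - min (M - t + s) M + s"
      using st by (simp add: min_def)
    moreover have "T0_oplus k (T0_neg k (T0_oplus k (T0_neg k X) Y)) Y =
        T0 k (min (M - min (M - s + t) M + t) M)"
      using st by (simp add: oplus neg)
    moreover have "T0_oplus k (T0_neg k (T0_oplus k (T0_neg k Y) X)) X =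
        T0 k (min (M - min (M - t + s) M + s) M)"
      using st by (simp add: oplus neg)
    ultimately show "T0_oplus k (T0_neg k (T0_oplus k (T0_neg k X) Y)) Y =
        T0_oplus k (T0_neg k (T0_oplus k (T0_neg k Y) X)) X"
      by metis
  next
    show "comm_monoid \<lparr>carrier = T0 k ` {0..M}, monoid.mult = T0_oplus k, one = T0 k 0\<rparr>"
    proof (rule comm_monoidI, goal_cases)
      case (3 x y z)
      then obtain r s t where rst: "0 \<le> r" "r \<le> M" "0 \<le> s" "s \<le> M" "0 \<le> t" "t \<le> M"
        "x = T0 k r" "y = T0 k s" "z = T0 k t"
        by auto
      \<comment> \<open>Associativity: because the summands are nonnegative, an inner truncation
        forces the outer one, and both sides equal min (r + s + t) M.\<close>
      have "min (min (r + s) M + t) M = min (r + min (s + t) M) M"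
        using rst by (simp add: min_def)
      then show ?case
        using rst by (simp add: oplus)
    qed (use M in \<open>auto simp: oplus add.commute\<close>)
  qed (use M in \<open>auto simp: oplus neg\<close>)
qed

end

text \<open>The conjuncts before the last confirm that the definite descriptions in
  \<open>T0\<close>, \<open>T1\<close>, \<open>T0_oplus\<close> and \<open>T0_neg\<close> take their
  intended values and that the top element is the whole punctured square.\<close>

theorem theorem6:
  fixes k :: real
  assumes "0 < k" and "k < 1"
  shows "bij_betw (phi k) {0..1} {0..1 - k\<^sup>2}
    \<and> (\<forall>l\<in>{0..1}. T0 k (phi k l) = lower_strip k l \<and> T1 k (phi k l) = upper_strip k l)
    \<and> (\<forall>a\<in>{0..1}. \<forall>b\<in>{0..1}. T0_oplus k (T0 k (phi k a)) (T0 k (phi k b)) =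
          T0 k (measure lebesgue (T0 k (phi k a) \<union> T1 k (phi k b))))
    \<and> (\<forall>l\<in>{0..1}. T0_neg k (T0 k (phi k l)) = T0 k ((1 - k\<^sup>2) - phi k l))
    \<and> T0 k (1 - k\<^sup>2) = Q - Q1 k
    \<and> mv_algebra (T0_family k) (T0_oplus k) (T0_neg k) (T0 k 0) (T0 k (1 - k\<^sup>2))"
  using assms bij_betw_phi[of k] T0_phi[of k] T1_phi[of k] T0_oplus_phi[of k] T0_neg_phi[of k]
    T0_phi[of k 1] phi_1[of k] mv_algebra_T0[of k]
  by (auto simp: lower_strip_1)

end
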